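(* Let $A$ be a four-dimensional absolute-valued algebra with a left unit satisfying $(x^2,x^2,x^2)=0$ for all $x\in A$. Then $A$ is isomorphic to one of $\mathbb{H}$, ${}^*\mathbb{H}$, ${}^*\mathbb{H}(i,1)$. Among these, ${}^*\mathbb{H}(i,1)$ has degree $4$ and the other two have degree $2$.
   Context: An absolute-valued algebra is a nonzero real algebra with a norm satisfying $\|xy\|=\|x\|\|y\|$. $(x,y,z)=(xy)z-x(yz)$. ${}^*\mathbb{H}$ is the normed space $\mathbb{H}$ with product $x\odot y=\bar x y$, and ${}^*\mathbb{H}(i,1)$ is $\mathbb{H}$ with product $x\odot y=\bar x\, i\, y$, where $\bar x$ is quaternion conjugation. The degree of a finite-dimensional algebra is the smallest $n$ such that every single-generated subalgebra has dimension $\le n$. *)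

theory Defs
  imports "HOL-Analysis.Analysis"
begin

definition absolute_valued :: "('a::real_normed_vector \<Rightarrow> 'a \<Rightarrow> 'a) \<Rightarrow> bool" where
  "absolute_valued m \<longleftrightarrow> bilinear m \<and> (UNIV :: 'a set) \<noteq> {0} \<and>
     (\<forall>x y. norm (m x y) = norm x * norm y)"

definition has_left_unit :: "('a \<Rightarrow> 'a \<Rightarrow> 'a) \<Rightarrow> bool" where
  "has_left_unit m \<longleftrightarrow> (\<exists>e. \<forall>x. m e x = x)"

definition associator :: "('a::ab_group_add \<Rightarrow> 'a \<Rightarrow> 'a) \<Rightarrow> 'a \<Rightarrow> 'a \<Rightarrow> 'a \<Rightarrow> 'a" where
  "associator m x y z = m (m x y) z - m x (m y z)"

definition alg_iso :: "('a::real_vector \<Rightarrow> 'a \<Rightarrow> 'a) \<Rightarrow> ('b::real_vector \<Rightarrow> 'b \<Rightarrow> 'b) \<Rightarrow> ('a \<Rightarrow> 'b) \<Rightarrow> bool" where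
  "alg_iso m1 m2 f \<longleftrightarrow> linear f \<and> bij f \<and> (\<forall>x y. f (m1 x y) = m2 (f x) (f y))"

definition alg_isomorphic :: "('a::real_vector \<Rightarrow> 'a \<Rightarrow> 'a) \<Rightarrow> ('b::real_vector \<Rightarrow> 'b \<Rightarrow> 'b) \<Rightarrow> bool" where
  "alg_isomorphic m1 m2 \<longleftrightarrow> (\<exists>f. alg_iso m1 m2 f)"

definition gen_subalg :: "('a::real_vector \<Rightarrow> 'a \<Rightarrow> 'a) \<Rightarrow> 'a \<Rightarrow> 'a set" where
  "gen_subalg m x = \<Inter>{S. subspace S \<and> x \<in> S \<and> (\<forall>a\<in>S. \<forall>b\<in>S. m a b \<in> S)}"

definition alg_degree :: "('a::real_vector \<Rightarrow> 'a \<Rightarrow> 'a) \<Rightarrow> nat" where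
  "alg_degree m = (LEAST n. \<forall>x. dim (gen_subalg m x) \<le> n)"

text \<open>Coordinates: q = q$1 + q$2 i + q$3 j + q$4 k.\<close>
definition qmult :: "real^4 \<Rightarrow> real^4 \<Rightarrow> real^4" where
  "qmult p q = vector
    [p$1*q$1 - p$2*q$2 - p$3*q$3 - p$4*q$4,
     p$1*q$2 + p$2*q$1 + p$3*q$4 - p$4*q$3,
     p$1*q$3 - p$2*q$4 + p$3*q$1 + p$4*q$2,
     p$1*q$4 + p$2*q$3 - p$3*q$2 + p$4*q$1]"

definition qconj :: "real^4 \<Rightarrow> real^4" where
  "qconj q = vector [q$1, - q$2, - q$3, - q$4]"

definition qi :: "real^4" where
  "qi = vector [0, 1, 0, 0]"

definition H_mult :: "real^4 \<Rightarrow> real^4 \<Rightarrow> real^4" where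
  "H_mult = qmult"

definition starH_mult :: "real^4 \<Rightarrow> real^4 \<Rightarrow> real^4" where
  "starH_mult x y = qmult (qconj x) y"

definition starHi1_mult :: "real^4 \<Rightarrow> real^4 \<Rightarrow> real^4" where
  "starHi1_mult x y = qmult (qmult (qconj x) qi) y"

end

theory Submission
  imports Defs
begin

text \<open>Averaging an auxiliary Euclidean square norm of \<open>z x\<close> over the unit ball of \<open>z\<close> shows that the norm
  comes from an inner product. With \<open>e\<close> the left unit and \<open>\<phi> x = x e\<close>, the product
  \<open>x \<star> y = \<phi>\<^sup>-\<^sup>1(x) y\<close> is a unital composition product, so every orthonormal pair of imaginary vectors
  spans a quaternion table. The associator identity becomes \<open>\<phi>(\<phi>(p) \<star> p) = \<phi>(p) \<star> \<phi>(p)\<close> for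
  \<open>p = \<phi>(x) \<star> x\<close>; its first-order part at \<open>x = e + t v\<close> gives \<open>\<phi>\<^sup>2 = id\<close>. On imaginary vectors \<open>\<phi>\<close> is
  then \<open>id\<close>, \<open>- id\<close>, or has eigenvectors of both signs; in the last case the identity at
  \<open>x = u + v\<close> leaves only \<open>diag(-1, 1, 1)\<close>. These three cases are the three algebras.\<close>


section \<open>Integrals over compact sets and linear maps preserving them\<close>

lemma absolutely_integrable_on_compact:
  fixes F :: "'a::euclidean_space \<Rightarrow> 'b::euclidean_space"
  assumes "compact B" "continuous_on B F"
  shows "F absolutely_integrable_on B"
proof -
  have "integrable lborel (\<lambda>x. indicator B x *\<^sub>R F x)"
    by (rule borel_integrable_compact[OF assms])
  then show ?thesis
    unfolding set_integrable_def by (intro integrable_completion[THEN iffD2]) auto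
qed

text \<open>A continuous nonnegative function with zero integral over a box vanishes on that box. A
  box inside \<open>B\<close> settles the claim because an open box is never the single point 0. The
  value at 0 is left free so that the lemma covers \<open>z \<bullet> z\<close>.\<close>

lemma integral_compact_pos:
  fixes F :: "'a::euclidean_space \<Rightarrow> real"
  assumes B: "compact B" "interior B \<noteq> {}" and F: "continuous_on UNIV F" "\<And>z. 0 \<le> F z" "\<And>z. z \<noteq> 0 \<Longrightarrow> 0 < F z"
  shows "0 < integral B F"
proof -
  have int: "F integrable_on S" if "compact S" for S
    by (rule absolutely_integrable_on_compact[OF that continuous_on_subset[OF F(1)],
          THEN set_lebesgue_integral_eq_integral(1)]) simp
  from B(2) obtain x where "x \<in> interior B" by blast
  then obtain a b where x: "x \<in> box a b" and ab: "cbox a b \<subseteq> interior B"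
    using open_contains_cbox open_interior by metis
  have "box a b \<noteq> {0}" by (metis open_box not_open_singleton)
  with x obtain y where y: "y \<in> cbox a b" "y \<noteq> 0" using box_subset_cbox by blast
  have "integral (cbox a b) F \<noteq> 0"
    using integral_cbox_eq_0_iff[of a b F] F x y continuous_on_subset
    by (metis empty_iff less_irrefl subset_UNIV)
  moreover have "0 \<le> integral (cbox a b) F"
    by (rule integral_nonneg[OF int]) (use F in auto)
  moreover have "integral (cbox a b) F \<le> integral B F"
    using ab interior_subset F(2) by (intro integral_subset_le int B compact_cbox) blast+
  ultimately show ?thesis by simp
qed

text \<open>The change of variables produces the factor \<open>\<bar>det (matrix g)\<bar>\<close>.
  For the constant function 1 both integrals are the positive volume of \<open>B\<close>, so this
  factor is 1.\<close>

lemma integral_invariant_linear: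
  fixes g :: "real^4 \<Rightarrow> real^4" and F :: "real^4 \<Rightarrow> real"
  assumes B: "compact B" "interior B \<noteq> {}" and g: "linear g" "g ` B = B" and F: "continuous_on UNIV F"
  shows "integral B (\<lambda>z. F (g z)) = integral B F"
proof -
  have *: "integral B G = \<bar>det (matrix g)\<bar> * integral B (\<lambda>z. G (g z))" if G: "continuous_on UNIV G"
    for G :: "real^4 \<Rightarrow> real"
  proof -
    \<comment> \<open>The substitution rule is applied to an integrand with values in
      \<open>real^1\<close>; the scalar equation is its only component.\<close>
    let ?f = "\<lambda>z. vec (G z) :: real^1"
    have cf: "continuous_on UNIV ?f"
      using G unfolding vec_def by (intro continuous_intros)
    have cg: "continuous_on UNIV (\<lambda>z. ?f (g z))"
      using continuous_on_compose2[OF cf linear_continuous_on[OF g(1)[unfolded linear_conv_bounded_linear]]] by simp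
    have a: "?f absolutely_integrable_on B" "(\<lambda>z. ?f (g z)) absolutely_integrable_on B"
      using absolutely_integrable_on_compact[OF B(1)] cf cg continuous_on_subset by (blast)+
    have "integral B ?f = \<bar>det (matrix g)\<bar> *\<^sub>R integral B (?f \<circ> g)"
      using integral_change_of_variables_linear[OF g(1), where S = B and f = ?f] g(2) a by simp
    then have "integral B ?f $ 1 = \<bar>det (matrix g)\<bar> * integral B (\<lambda>z. ?f (g z)) $ 1"
      by (simp add: o_def)
    then show ?thesis
      using a[THEN set_lebesgue_integral_eq_integral(1)]
      by (simp flip: integral_component_eq_cart)
  qed
  have "0 < integral B (\<lambda>z::real^4. 1::real)"
    by (rule integral_compact_pos[OF B]) auto
  then have "\<bar>det (matrix g)\<bar> = 1"
    using *[of "\<lambda>_. 1"] by simp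
  then show ?thesis using *[OF F] by simp
qed

section \<open>Algebra isomorphisms and the passage to a Euclidean norm on four-space\<close>

lemma linear_inv_of_bij:
  fixes f :: "'a::real_vector \<Rightarrow> 'b::real_vector"
  assumes "linear f" "bij f"
  shows "linear (inv f)"
proof (rule linearI)
  have [simp]: "f (inv f y) = y" for y using assms(2) by (simp add: bij_is_surj surj_f_inv_f)
  fix x y :: 'b and r :: real
  show "inv f (x + y) = inv f x + inv f y"
    by (rule injD[OF bij_is_inj[OF assms(2)]]) (simp add: linear_add[OF assms(1)])
  show "inv f (r *\<^sub>R x) = r *\<^sub>R inv f x"
    by (rule injD[OF bij_is_inj[OF assms(2)]]) (simp add: linear_scale[OF assms(1)])
qed

lemma alg_iso_inv:
  assumes "alg_iso m1 m2 f"
  shows "alg_iso m2 m1 (inv f)"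
proof -
  have f: "linear f" "bij f" "f (m1 x y) = m2 (f x) (f y)" for x y
    using assms by (auto simp: alg_iso_def)
  have [simp]: "f (inv f y) = y" for y using f(2) by (simp add: bij_is_surj surj_f_inv_f)
  have "inv f (m2 x y) = m1 (inv f x) (inv f y)" for x y
    by (rule injD[OF bij_is_inj[OF f(2)]]) (simp add: f(3))
  then show ?thesis
    using f linear_inv_of_bij by (auto simp: alg_iso_def bij_imp_bij_inv)
qed

lemma alg_iso_comp:
  assumes "alg_iso m1 m2 f" "alg_iso m2 m3 g"
  shows "alg_iso m1 m3 (g \<circ> f)"
  using assms by (auto simp: alg_iso_def linear_compose bij_comp)

text \<open>An infinite basis would have \<open>card\<close> 0, so dimension 4 really provides a
  finite basis. The resulting coordinates carry compactness and integration over to a type known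
  only as a normed space.\<close>

lemma linear_bij_real4:
  assumes "dim (UNIV :: 'a::real_vector set) = 4"
  obtains f :: "real^4 \<Rightarrow> 'a::real_vector" where "linear f" "bij f"
proof -
  obtain B :: "'a set" where B: "independent B" "span B = UNIV" "card B = 4"
    using basis_exists[of "UNIV :: 'a set"] assms by (metis top.extremum_uniqueI)
  obtain C :: "(real^4) set" where C: "independent C" "span C = UNIV" "card C = 4"
    using basis_exists[of "UNIV :: (real^4) set"] by (auto simp: top.extremum_unique)
  have "finite B" "finite C" using B(3) C(3) by (auto intro: card_ge_0_finite)
  then obtain f :: "real^4 \<Rightarrow> 'a" where "linear f" "f ` UNIV = UNIV" "inj f"
    using real_vector.finite_basis_to_basis_subspace_isomorphism[of UNIV UNIV C B] B C assms
    by auto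
  then show ?thesis using that by (auto simp: bij_def)
qed

text \<open>For a unit vector \<open>x\<close>, right multiplication by \<open>x\<close> is a linear isometry, so it preserves the unit
  ball and Lebesgue measure. Hence the integral of \<open>\<parallel>z x\<parallel>\<^sup>2\<close> over the unit ball, with respect to an
  auxiliary Euclidean norm, is a quadratic form in \<open>x\<close> that is constant on the unit sphere.\<close>

lemma absolute_valued_inner_product:
  fixes m :: "'a::real_normed_vector \<Rightarrow> 'a \<Rightarrow> 'a"
  assumes m: "absolute_valued m" and dim4: "dim (UNIV :: 'a set) = 4"
  obtains ip :: "'a::real_normed_vector \<Rightarrow> 'a \<Rightarrow> real"
  where "bilinear ip" "\<And>x y. ip x y = ip y x" "\<And>x. ip x x = (norm x)\<^sup>2"
proof -
  obtain f :: "real^4 \<Rightarrow> 'a" where f: "linear f" "bij f"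
    using linear_bij_real4[OF dim4] .
  have bf: "bounded_linear f" using f(1) linear_conv_bounded_linear by blast
  define g where "g = inv f"
  have g: "linear g" unfolding g_def using f by (rule linear_inv_of_bij)
  have fg: "f (g x) = x" for x using f(2) by (simp add: g_def bij_is_surj surj_f_inv_f)
  have gf: "g (f x) = x" for x using f(2) by (simp add: g_def bij_is_inj)
  have bm: "bilinear m" and nm: "norm (m x y) = norm x * norm y" for x y
    using m by (auto simp: absolute_valued_def)
  define B where "B = {z. norm (f z) \<le> 1}"
  define R where "R x z = g (m (f z) x)" for x z
  have lR: "linear (R x)" for x
    using linear_compose[OF linear_compose[OF f(1)] g, of "\<lambda>z. m z x"] bm
    by (simp add: bilinear_def o_def R_def[abs_def])
  have cR: "continuous_on S (R x)" for x S
    using lR linear_conv_bounded_linear linear_continuous_on by blast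
  have nR: "norm (f (R x z)) = norm (f z) * norm x" for x z
    by (simp add: R_def fg nm)
  have cB: "compact B"
  proof -
    have c: "continuous_on S (\<lambda>z. norm (f z))" for S
      by (intro continuous_intros linear_continuous_on bf)
    have "closed B" unfolding B_def by (intro closed_Collect_le c continuous_intros)
    \<comment> \<open>The minimum of \<open>norm (f z)\<close> on the Euclidean unit sphere is
      positive; its reciprocal bounds the Euclidean norm on \<open>B\<close>.\<close>
    obtain z0 :: "real^4" where z0: "norm z0 = 1" "\<And>z. norm z = 1 \<Longrightarrow> norm (f z0) \<le> norm (f z)"
      using continuous_attains_inf[OF compact_sphere _ c, of 0 1] vector_choose_size[of 1]
      by (auto simp: sphere_def)
    have "f z0 \<noteq> 0" using z0(1) gf linear_0[OF g] by (metis norm_zero zero_neq_one)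
    have "norm z \<le> 1 / norm (f z0)" if "z \<in> B" for z
    proof (cases "z = 0")
      case False
      then have "norm (f z0) \<le> norm (f (inverse (norm z) *\<^sub>R z))"
        by (intro z0(2)) simp
      also have "\<dots> \<le> inverse (norm z)"
        using that by (simp add: linear_scale[OF f(1)] B_def mult_left_le)
      finally show ?thesis using False \<open>f z0 \<noteq> 0\<close> by (simp add: field_simps)
    qed simp
    then have "bounded B" by (auto simp: bounded_iff)
    with \<open>closed B\<close> show ?thesis by (simp add: compact_eq_bounded_closed)
  qed
  have iB: "interior B \<noteq> {}"
  proof -
    obtain b where b: "b > 0" "\<And>z. norm (f z) \<le> b * norm z"
      using linear_bounded_pos[OF f(1)] by blast
    have "ball 0 (1 / b) \<subseteq> B"
    proof
      fix z :: "real^4" assume "z \<in> ball 0 (1 / b)"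
      then have "b * norm z \<le> 1" using b(1) by (simp add: field_simps)
      then show "z \<in> B" using b(2)[of z] by (simp add: B_def)
    qed
    then have "ball 0 (1 / b) \<subseteq> interior B" by (simp add: interior_maximal)
    moreover have "0 \<in> ball (0::real^4) (1 / b)" using b(1) by simp
    ultimately show ?thesis by blast
  qed
  have RB: "R x ` B = B" if "norm x = 1" for x
  proof -
    have "z = 0" if "R x z = 0" for z
    proof -
      have "norm (f z) = 0" using nR[of x z] that \<open>norm x = 1\<close> linear_0[OF f(1)] by simp
      then show ?thesis using gf[of z] linear_0[OF g] by simp
    qed
    then have "inj (R x)" using linear_injective_0[OF lR] by blast
    then have "surj (R x)" using lR linear_injective_imp_surjective by blast
    have "norm (f (R x z)) = norm (f z)" for z using nR that by simp
    with \<open>surj (R x)\<close> show ?thesis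
      unfolding B_def by (auto simp: image_iff surj_def) metis
  qed
  \<comment> \<open>This turns out to be the value of the unnormalized form at every unit vector,
    since substituting \<open>R y\<close> does not change the integral.\<close>
  define c where "c = integral B (\<lambda>z. z \<bullet> z)"
  have "c > 0" unfolding c_def
    by (rule integral_compact_pos[OF cB iB]) (auto intro!: continuous_intros)
  define ip where "ip x y = integral B (\<lambda>z. R x z \<bullet> R y z) / c" for x y
  have int: "(\<lambda>z. R x z \<bullet> R y z) integrable_on B" for x y
    by (rule absolutely_integrable_on_compact[OF cB, THEN set_lebesgue_integral_eq_integral(1)])
      (intro continuous_intros cR)
  have Radd: "R (x + y) z = R x z + R y z" and Rscale: "R (r *\<^sub>R x) z = r *\<^sub>R R x z" for x y z r
    by (simp_all add: R_def bilinear_radd[OF bm] bilinear_rmul[OF bm] linear_add[OF g] linear_scale[OF g])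
  have "bilinear ip"
    unfolding bilinear_def
    by (auto intro!: linearI simp: ip_def Radd Rscale inner_add_left inner_add_right
        integral_add[OF int int] add_divide_distrib)
  moreover have "ip x y = ip y x" for x y
    by (simp add: ip_def inner_commute)
  moreover have "ip x x = (norm x)\<^sup>2" for x
  proof (cases "x = 0")
    case True
    then show ?thesis using Rscale[of 0] by (simp add: ip_def)
  next
    case False
    define y where "y = inverse (norm x) *\<^sub>R x"
    have x: "x = norm x *\<^sub>R y" and "norm y = 1" using False by (auto simp: y_def)
    have "integral B (\<lambda>z. R y z \<bullet> R y z) = c" unfolding c_def
      by (rule integral_invariant_linear[OF cB iB lR RB[OF \<open>norm y = 1\<close>]]) (intro continuous_intros)
    then have "ip y y = 1" using \<open>c > 0\<close> by (simp add: ip_def)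
    have "ip x x = norm x * (norm x * ip y y)"
      by (metis x bilinear_lmul[OF \<open>bilinear ip\<close>] bilinear_rmul[OF \<open>bilinear ip\<close>] real_scaleR_def)
    then show ?thesis using \<open>ip y y = 1\<close> by (simp add: power2_eq_square)
  qed
  ultimately show ?thesis using that by blast
qed

text \<open>Gram-Schmidt for \<open>ip\<close> can continue as long as fewer than four vectors have
  been found, since they do not span. The four orthonormal vectors are then the images of the
  standard basis.\<close>

lemma absolute_valued_isometry:
  fixes m :: "'a::real_normed_vector \<Rightarrow> 'a \<Rightarrow> 'a"
  assumes m: "absolute_valued m" and dim4: "dim (UNIV :: 'a set) = 4"
  obtains T :: "real^4 \<Rightarrow> 'a::real_normed_vector"
  where "linear T" "bij T" "\<And>x. norm (T x) = norm x"
proof -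
  obtain ip where bi: "bilinear ip" and sym: "\<And>x y. ip x y = ip y x"
    and ipn: "\<And>x :: 'a. ip x x = (norm x)\<^sup>2"
    using absolute_valued_inner_product[OF m dim4] by blast
  have sumL: "ip (\<Sum>i\<in>S. F i) y = (\<Sum>i\<in>S. ip (F i) y)" for F y and S :: "'i set"
    using bi linear_sum[of "\<lambda>x. ip x y"] by (simp add: bilinear_def)
  have sumR: "ip y (\<Sum>i\<in>S. F i) = (\<Sum>i\<in>S. ip y (F i))" for F y and S :: "'i set"
    using bi linear_sum[of "ip y"] by (simp add: bilinear_def)
  have "\<exists>S. finite S \<and> card S = k \<and> (\<forall>x\<in>S. \<forall>y\<in>S. ip x y = (if x = y then 1 else 0))"
    if "k \<le> 4" for k
    using that
  proof (induction k)
    case 0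
    then show ?case by (intro exI[of _ "{}"]) auto
  next
    case (Suc k)
    then obtain S where S: "finite S" "card S = k" "\<And>x y. x \<in> S \<Longrightarrow> y \<in> S \<Longrightarrow> ip x y = (if x = y then 1 else 0)"
      by auto
    have "span S \<noteq> UNIV"
      using dim_le_card[of UNIV S] S(1,2) dim4 Suc.prems by auto
    then obtain x where x: "x \<notin> span S" by blast
    define y where "y = x - (\<Sum>s\<in>S. ip x s *\<^sub>R s)"
    have y0: "y \<noteq> 0"
    proof
      assume "y = 0"
      then have "x = (\<Sum>s\<in>S. ip x s *\<^sub>R s)" by (simp add: y_def)
      also have "\<dots> \<in> span S" by (intro span_sum span_scale span_base)
      finally show False using x by simp
    qed
    have yS: "ip y s = 0" if "s \<in> S" for s
    proof -
      have "ip y s = ip x s - (\<Sum>t\<in>S. ip x t * ip t s)"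
        by (simp add: y_def bilinear_lsub[OF bi] sumL bilinear_lmul[OF bi])
      also have "(\<Sum>t\<in>S. ip x t * ip t s) = (\<Sum>t\<in>S. if t = s then ip x t else 0)"
        using S(3) that by (intro sum.cong) auto
      finally show ?thesis using S(1) that by simp
    qed
    define z where "z = inverse (norm y) *\<^sub>R y"
    have zS: "ip z s = 0" "ip s z = 0" if "s \<in> S" for s
      using yS[OF that] sym[of s z] by (simp_all add: z_def bilinear_lmul[OF bi])
    have zz: "ip z z = 1" using y0 by (simp add: ipn z_def)
    then have "z \<notin> S" using zS by fastforce
    then have "card (insert z S) = Suc k" using S(1,2) by simp
    moreover have "\<forall>x\<in>insert z S. \<forall>y\<in>insert z S. ip x y = (if x = y then 1 else 0)"
      using \<open>z \<notin> S\<close> S(3) zS zz by (simp add: ball_simps) blast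
    ultimately show ?case using S(1) by blast
  qed
  from this[of 4] obtain S where S: "finite S" "card S = 4"
    and oS: "\<And>x y. x \<in> S \<Longrightarrow> y \<in> S \<Longrightarrow> ip x y = (if x = y then 1 else 0)" by auto
  obtain b where b: "bij_betw b (UNIV :: 4 set) S"
    using finite_same_card_bij[of "UNIV :: 4 set" S] S by auto
  have ob: "ip (b i) (b j) = (if i = j then 1 else 0)" for i j
    using oS[of "b i" "b j"] b by (auto simp: bij_betw_def inj_on_def)
  define T where "T x = (\<Sum>i\<in>UNIV. x $ i *\<^sub>R b i)" for x :: "real^4"
  have lT: "linear T"
    by (rule linearI) (simp_all add: T_def scaleR_left_distrib sum.distrib scaleR_sum_right)
  have "(norm (T x))\<^sup>2 = (norm x)\<^sup>2" for x
  proof -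
    have "ip (T x) (T x) = x \<bullet> x"
      by (simp add: T_def sumL sumR bilinear_lmul[OF bi] bilinear_rmul[OF bi] ob if_distrib
          inner_vec_def cong: if_cong)
    then show ?thesis by (simp add: ipn power2_norm_eq_inner)
  qed
  then have nT: "norm (T x) = norm x" for x by simp
  have iT: "inj T" unfolding linear_injective_0[OF lT] using nT norm_eq_zero by metis
  obtain f :: "real^4 \<Rightarrow> 'a" where f: "linear f" "bij f"
    using linear_bij_real4[OF dim4] .
  \<comment> \<open>Injective linear maps of \<open>real^4\<close> into itself are surjective;
    composing with \<open>inv f\<close> brings \<open>T\<close> into that situation.\<close>
  have "linear (inv f \<circ> T)" by (intro linear_compose lT linear_inv_of_bij f)
  moreover have "inj (inv f \<circ> T)" using f(2) iT by (simp add: bij_imp_bij_inv bij_is_inj inj_compose)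
  ultimately have "surj (inv f \<circ> T)" using linear_injective_imp_surjective by blast
  then have "surj (f \<circ> (inv f \<circ> T))" by (rule comp_surj[OF _ bij_is_surj[OF f(2)]])
  moreover have "f \<circ> (inv f \<circ> T) = T" using f(2) by (simp add: fun_eq_iff bij_is_surj surj_f_inv_f)
  ultimately have "bij T" using iT by (simp add: bij_def)
  with lT nT that show ?thesis by blast
qed

text \<open>Pulling the product back along the isometry makes the Euclidean norm of
  \<open>real^4\<close> multiplicative, so that inner products can be used from here on.\<close>

lemma absolute_valued_euclidean_model:
  fixes m :: "'a::real_normed_vector \<Rightarrow> 'a \<Rightarrow> 'a"
  assumes m: "absolute_valued m" and dim4: "dim (UNIV :: 'a set) = 4"
  obtains m' :: "real^4 \<Rightarrow> real^4 \<Rightarrow> real^4" and T where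
    "absolute_valued m'" "alg_iso m' m T"
proof -
  obtain T :: "real^4 \<Rightarrow> 'a" where T: "linear T" "bij T" "\<And>x. norm (T x) = norm x"
    using absolute_valued_isometry[OF m dim4] by blast
  define m' where "m' x y = inv T (m (T x) (T y))" for x y
  have Tm: "T (m' x y) = m (T x) (T y)" for x y
    using T(2) by (simp add: m'_def bij_is_surj surj_f_inv_f)
  have bm: "bilinear m" and nm: "norm (m x y) = norm x * norm y" for x y
    using m by (auto simp: absolute_valued_def)
  have li: "linear (inv T)" using T linear_inv_of_bij by blast
  have "bilinear m'"
    unfolding bilinear_def
    by (auto intro!: linearI simp: m'_def linear_add[OF T(1)] linear_scale[OF T(1)]
        linear_add[OF li] linear_scale[OF li] bilinear_ladd[OF bm] bilinear_radd[OF bm]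
        bilinear_lmul[OF bm] bilinear_rmul[OF bm])
  moreover have "norm (m' x y) = norm x * norm y" for x y
  proof -
    have "norm (m' x y) = norm (T (m' x y))" by (simp only: T(3))
    also have "\<dots> = norm x * norm y" by (simp only: Tm nm T(3))
    finally show ?thesis .
  qed
  moreover have "(UNIV :: (real^4) set) \<noteq> {0}"
    using axis_eq_0_iff[of 1 "1::real"] by (metis UNIV_I singletonD zero_neq_one)
  ultimately have "absolute_valued m'" by (simp add: absolute_valued_def)
  moreover have "alg_iso m' m T" using T Tm by (simp add: alg_iso_def)
  ultimately show ?thesis using that by blast
qed

text \<open>The odd part in \<open>t\<close> involves only \<open>d1\<close> and \<open>d3\<close>,
  and its values at 1 and 2 already force \<open>d1 = 0\<close>.\<close>

lemma linear_part_of_quartic_zero: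
  fixes d1 d2 d3 d4 :: "'a::real_vector"
  assumes "\<And>t::real. t *\<^sub>R d1 + t^2 *\<^sub>R d2 + t^3 *\<^sub>R d3 + t^4 *\<^sub>R d4 = 0"
  shows "d1 = 0"
proof -
  define F where "F t = t *\<^sub>R d1 + t^2 *\<^sub>R d2 + t^3 *\<^sub>R d3 + t^4 *\<^sub>R d4" for t :: real
  have "F t - F (-t) = 2 *\<^sub>R (t *\<^sub>R d1 + t^3 *\<^sub>R d3)" for t
    by (simp add: F_def scaleR_2)
  moreover have "F t = 0" for t by (simp only: F_def assms)
  ultimately have F: "t *\<^sub>R d1 + t^3 *\<^sub>R d3 = 0" for t by simp
  have "d3 = - d1" using F[of 1] by (simp add: add_eq_0_iff)
  moreover have "2 *\<^sub>R d1 + 8 *\<^sub>R d3 = 0" using F[of 2] by simp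
  ultimately have "2 *\<^sub>R d1 - 8 *\<^sub>R d1 = 0" by simp
  then have "(2 - 8) *\<^sub>R d1 = 0" by (simp only: scaleR_diff_left)
  then show ?thesis by simp
qed

section \<open>Unital composition products on a Euclidean space\<close>

locale unital_composition =
  fixes star :: "'a::euclidean_space \<Rightarrow> 'a \<Rightarrow> 'a" (infixl "\<star>" 70) and e :: 'a
  assumes bilinear_star: "bilinear star"
    and norm_star: "norm (x \<star> y) = norm x * norm y"
    and left_unit: "e \<star> x = x" and right_unit: "x \<star> e = x"
begin

lemmas star_simps = bilinear_ladd[OF bilinear_star] bilinear_radd[OF bilinear_star]
  bilinear_lsub[OF bilinear_star] bilinear_rsub[OF bilinear_star]
  bilinear_lneg[OF bilinear_star] bilinear_rneg[OF bilinear_star]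
  bilinear_lmul[OF bilinear_star] bilinear_rmul[OF bilinear_star]
  bilinear_lzero[OF bilinear_star] bilinear_rzero[OF bilinear_star]
  left_unit right_unit

lemma inner_star_self: "(x \<star> y) \<bullet> (x \<star> y) = (x \<bullet> x) * (y \<bullet> y)"
  by (simp add: norm_star power_mult_distrib flip: power2_norm_eq_inner)

lemma inner_star_left: "(x \<star> y) \<bullet> (x \<star> z) = (x \<bullet> x) * (y \<bullet> z)"
  using inner_star_self[of x "y + z"] inner_star_self[of x y] inner_star_self[of x z]
  by (simp add: star_simps inner_add_left inner_add_right inner_commute algebra_simps)

lemma inner_star_right: "(x \<star> z) \<bullet> (y \<star> z) = (x \<bullet> y) * (z \<bullet> z)"
  using inner_star_self[of "x + y" z] inner_star_self[of x z] inner_star_self[of y z]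
  by (simp add: star_simps inner_add_left inner_add_right inner_commute algebra_simps)

text \<open>This is the full linearization of the composition law. Putting the unit for one factor
  turns it into the two adjoint rules for imaginary elements below.\<close>

lemma inner_star_exchange: "(x \<star> y) \<bullet> (z \<star> w) + (x \<star> w) \<bullet> (z \<star> y) = 2 * (x \<bullet> z) * (y \<bullet> w)"
  using inner_star_right[of x "y + w" z] inner_star_right[of x y z] inner_star_right[of x w z]
  by (simp add: star_simps inner_add_left inner_add_right inner_commute algebra_simps)

lemma inner_unit: "e \<bullet> e = 1"
proof -
  obtain x :: 'a where "x \<noteq> 0" using nonempty_Basis nonzero_Basis by blast
  then show ?thesis using inner_star_self[of e x] by (simp add: left_unit)
qed

lemma inner_imaginary_left: "u \<bullet> e = 0 \<Longrightarrow> (u \<star> x) \<bullet> y = - (x \<bullet> (u \<star> y))"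
  using inner_star_exchange[of u x e y] by (simp add: star_simps inner_commute)

lemma inner_imaginary_right: "u \<bullet> e = 0 \<Longrightarrow> (x \<star> u) \<bullet> y = - (x \<bullet> (y \<star> u))"
  using inner_star_exchange[of x u y e] by (simp add: star_simps inner_commute)

text \<open>Left multiplication by \<open>u\<close> is skew-adjoint and multiplies inner products by
  \<open>u \<bullet> u\<close>. Testing against all vectors therefore determines its square.\<close>

lemma imaginary_sq_left: "u \<bullet> e = 0 \<Longrightarrow> u \<star> (u \<star> x) = - ((u \<bullet> u) *\<^sub>R x)"
  by (subst vector_eq_ldot[symmetric])
    (metis inner_imaginary_left inner_commute inner_star_left inner_minus_right inner_scaleR_right)

lemma imaginary_sq_right: "u \<bullet> e = 0 \<Longrightarrow> (x \<star> u) \<star> u = - ((u \<bullet> u) *\<^sub>R x)"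
  by (subst vector_eq_ldot[symmetric])
    (metis inner_imaginary_right inner_commute inner_star_right inner_minus_right inner_scaleR_right mult.commute)

lemma imaginary_sq: "u \<bullet> e = 0 \<Longrightarrow> u \<star> u = - ((u \<bullet> u) *\<^sub>R e)"
  using imaginary_sq_left[of u e] by (simp add: right_unit)

text \<open>These are the cross terms of \<open>imaginary_sq\<close> at
  \<open>u + v\<close>.\<close>

lemma anticommute:
  assumes "u \<bullet> e = 0" "v \<bullet> e = 0" "u \<bullet> v = 0"
  shows "v \<star> u = - (u \<star> v)"
  using imaginary_sq[of "u + v"] assms
  by (simp add: star_simps imaginary_sq inner_add_left inner_add_right inner_commute algebra_simps
      eq_neg_iff_add_eq_0)

text \<open>Multiples of \<open>e\<close> cause no trouble, and for the imaginary part
  \<open>u\<close> of \<open>x\<close> both sides are \<open>- (u \<bullet> u)\<close> times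
  \<open>y\<close>. In the classification this law brings a factor to the far right, where it can be
  cancelled.\<close>

lemma left_alternative: "x \<star> (x \<star> y) = (x \<star> x) \<star> y"
proof -
  define a where "a = x \<bullet> e"
  define u where "u = x - a *\<^sub>R e"
  have u: "u \<bullet> e = 0" by (simp add: u_def a_def inner_diff_left inner_unit)
  have x: "x = a *\<^sub>R e + u" by (simp add: u_def)
  show ?thesis
    unfolding x by (simp add: star_simps imaginary_sq_left[OF u] imaginary_sq[OF u] algebra_simps)
qed

lemma star_right_cancel: "x \<star> z = y \<star> z \<Longrightarrow> z \<noteq> 0 \<Longrightarrow> x = y"
  using norm_star[of "x - y" z] by (simp add: star_simps)

end

section \<open>Quaternion tables spanned by orthonormal imaginary pairs\<close>

locale quaternion_frame = unital_composition star e
  for star :: "'a::euclidean_space \<Rightarrow> 'a \<Rightarrow> 'a" (infixl "\<star>" 70) and e :: 'a +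
  fixes u v :: 'a
  assumes orth: "u \<bullet> e = 0" "v \<bullet> e = 0" "u \<bullet> v = 0" and unit: "u \<bullet> u = 1" "v \<bullet> v = 1"
begin

definition w :: 'a where "w = u \<star> v"

lemma orth_w: "w \<bullet> e = 0" "w \<bullet> u = 0" "w \<bullet> v = 0" "w \<bullet> w = 1"
  using inner_imaginary_left[OF orth(1), of v e] inner_star_left[of u v e] inner_star_right[of u v e]
    inner_star_self[of u v] orth unit
  by (simp_all add: w_def star_simps inner_commute)

lemma frame_inner:
  "e \<bullet> e = 1" "u \<bullet> u = 1" "v \<bullet> v = 1" "w \<bullet> w = 1"
  "u \<bullet> e = 0" "v \<bullet> e = 0" "w \<bullet> e = 0" "u \<bullet> v = 0" "w \<bullet> u = 0" "w \<bullet> v = 0"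
  "e \<bullet> u = 0" "e \<bullet> v = 0" "e \<bullet> w = 0" "v \<bullet> u = 0" "u \<bullet> w = 0" "v \<bullet> w = 0"
  using orth unit orth_w inner_unit by (simp_all add: inner_commute)

lemma table:
  "u \<star> u = - e" "v \<star> v = - e" "w \<star> w = - e"
  "u \<star> v = w" "v \<star> u = - w" "u \<star> w = - v" "w \<star> u = v" "v \<star> w = u" "w \<star> v = - u"
proof -
  show uv: "u \<star> v = w" by (simp add: w_def)
  show uw: "u \<star> w = - v" using imaginary_sq_left[of u v] frame_inner by (simp add: w_def)
  show wv: "w \<star> v = - u" using imaginary_sq_right[of v u] frame_inner by (simp add: w_def)
  show "w \<star> u = v" using anticommute[of u w] uw frame_inner by simp
  show "v \<star> w = u" using anticommute[of w v] wv frame_inner by simp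
  show "v \<star> u = - w" using anticommute[of u v] uv frame_inner by simp
qed (use imaginary_sq frame_inner in simp_all)

definition comb :: "real^4 \<Rightarrow> 'a" where
  "comb q = q$1 *\<^sub>R e + q$2 *\<^sub>R u + q$3 *\<^sub>R v + q$4 *\<^sub>R w"

lemma linear_comb: "linear comb"
  by (rule linearI) (simp_all add: comb_def algebra_simps)

lemma inner_comb: "comb p \<bullet> comb q = p \<bullet> q"
  by (simp add: comb_def inner_add_left inner_add_right frame_inner inner_vec_def sum_4)

lemma inj_comb: "inj comb"
  unfolding linear_injective_0[OF linear_comb]
  using inner_comb by (metis inner_eq_zero_iff)

end

lemma vector_4 [simp]:
  "(vector [a, b, c, d] :: 'a::zero^4) $ 1 = a" "(vector [a, b, c, d] :: 'a^4) $ 2 = b"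
  "(vector [a, b, c, d] :: 'a^4) $ 3 = c" "(vector [a, b, c, d] :: 'a^4) $ 4 = d"
  unfolding vector_def by simp_all

text \<open>By the table \<open>e\<close>, \<open>u\<close>, \<open>v\<close>, \<open>w\<close>
  multiply like 1, i, j, k, so \<open>comb\<close> embeds the quaternions.\<close>

lemma (in quaternion_frame) comb_qmult: "comb (qmult p q) = comb p \<star> comb q"
  by (simp add: comb_def qmult_def star_simps table algebra_simps)

section \<open>The classification on Euclidean four-space\<close>

lemma ex_unit_orthogonal:
  fixes S :: "'a::euclidean_space set"
  assumes "finite S" "card S < DIM('a)"
  obtains x where "x \<bullet> x = 1" "\<And>s. s \<in> S \<Longrightarrow> x \<bullet> s = 0"
proof -
  have "dim S < DIM('a)" using dim_le_card'[OF assms(1)] assms(2) by linarith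
  then obtain y where y: "y \<noteq> 0" "\<And>s. s \<in> span S \<Longrightarrow> orthogonal y s"
    using orthogonal_to_subspace_exists by blast
  show ?thesis
  proof (rule that[of "inverse (norm y) *\<^sub>R y"])
    show "(inverse (norm y) *\<^sub>R y) \<bullet> (inverse (norm y) *\<^sub>R y) = 1"
      using y(1) by (simp add: dot_square_norm power2_eq_square)
    show "(inverse (norm y) *\<^sub>R y) \<bullet> s = 0" if "s \<in> S" for s
      using y(2)[of s] that by (simp add: span_base orthogonal_def)
  qed
qed

text \<open>At \<open>x = e + t v\<close> the identity \<open>sq\<close> is polynomial of degree at
  most 4 in \<open>t\<close>, with linear coefficient \<open>\<phi> (\<phi> a) - \<phi> a\<close>
  for \<open>a = v + \<phi> v\<close>. Injectivity gives \<open>\<phi> a = a\<close>, in which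
  \<open>\<phi> v\<close> cancels.\<close>

lemma (in unital_composition) involution_of_square_identity:
  assumes lin: "linear \<phi>" and inj: "inj \<phi>" and e: "\<phi> e = e"
    and sq: "\<And>x. \<phi> (\<phi> (\<phi> x \<star> x) \<star> (\<phi> x \<star> x)) = \<phi> (\<phi> x \<star> x) \<star> \<phi> (\<phi> x \<star> x)"
  shows "\<phi> (\<phi> v) = v"
proof -
  note phi = linear_add[OF lin] linear_scale[OF lin] e
  define a b where "a = v + \<phi> v" and "b = \<phi> v \<star> v"
  have "\<phi> (\<phi> a) - \<phi> a = 0"
  proof (rule linear_part_of_quartic_zero)
    fix t :: real
    define p where "p = e + t *\<^sub>R a + t^2 *\<^sub>R b"
    have "\<phi> (e + t *\<^sub>R v) \<star> (e + t *\<^sub>R v) = p"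
      by (simp add: p_def a_def b_def phi star_simps algebra_simps power2_eq_square)
    then have "\<phi> (\<phi> p \<star> p) - \<phi> p \<star> \<phi> p = 0"
      using sq[of "e + t *\<^sub>R v"] by simp
    also have "\<phi> (\<phi> p \<star> p) - \<phi> p \<star> \<phi> p = t *\<^sub>R (\<phi> (\<phi> a) - \<phi> a)
        + t^2 *\<^sub>R (\<phi> (\<phi> b) - \<phi> b + \<phi> (\<phi> a \<star> a) - \<phi> a \<star> \<phi> a)
        + t^3 *\<^sub>R (\<phi> (\<phi> a \<star> b) + \<phi> (\<phi> b \<star> a) - \<phi> a \<star> \<phi> b - \<phi> b \<star> \<phi> a)
        + t^4 *\<^sub>R (\<phi> (\<phi> b \<star> b) - \<phi> b \<star> \<phi> b)"
      by (simp add: p_def phi star_simps algebra_simps power2_eq_square power3_eq_cube power4_eq_xxxx)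
    finally show "t *\<^sub>R (\<phi> (\<phi> a) - \<phi> a)
        + t^2 *\<^sub>R (\<phi> (\<phi> b) - \<phi> b + \<phi> (\<phi> a \<star> a) - \<phi> a \<star> \<phi> a)
        + t^3 *\<^sub>R (\<phi> (\<phi> a \<star> b) + \<phi> (\<phi> b \<star> a) - \<phi> a \<star> \<phi> b - \<phi> b \<star> \<phi> a)
        + t^4 *\<^sub>R (\<phi> (\<phi> b \<star> b) - \<phi> b \<star> \<phi> b) = 0" .
  qed
  then have "\<phi> a = a" using inj by (simp add: inj_eq)
  then show ?thesis by (simp add: a_def phi)
qed

text \<open>The map \<open>k\<close> runs from the model \<open>m'\<close> to \<open>m\<close>,
  against the direction of \<open>alg_isomorphic\<close>, because frames parametrize the algebra by
  quaternions.\<close>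

lemma alg_isomorphicI:
  fixes m m' :: "real^4 \<Rightarrow> real^4 \<Rightarrow> real^4"
  assumes "linear k" "inj k" "\<And>x y. k (m' x y) = m (k x) (k y)"
  shows "alg_isomorphic m m'"
proof -
  have "alg_iso m' m k"
    using assms linear_injective_imp_surjective[of k] by (simp add: alg_iso_def bij_def)
  then show ?thesis using alg_iso_inv by (auto simp: alg_isomorphic_def)
qed

lemma real4_classification:
  fixes m :: "real^4 \<Rightarrow> real^4 \<Rightarrow> real^4"
  assumes m: "absolute_valued m" and e: "\<And>x. m e x = x"
    and assoc: "\<And>x. associator m (m x x) (m x x) (m x x) = 0"
  shows "alg_isomorphic m H_mult \<or> alg_isomorphic m starH_mult \<or> alg_isomorphic m starHi1_mult"
proof -
  have bm: "bilinear m" and nm: "norm (m x y) = norm x * norm y" for x y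
    using m by (auto simp: absolute_valued_def)
  have ne: "norm e = 1"
    using nm[of e "axis 1 1"] e by (simp add: norm_axis_1)
  define \<phi> where "\<phi> x = m x e" for x
  have lin: "linear \<phi>" using bm by (simp add: bilinear_def \<phi>_def[abs_def])
  have n\<phi>: "norm (\<phi> x) = norm x" for x by (simp add: \<phi>_def nm ne)
  have i\<phi>: "inj \<phi>"
    unfolding linear_injective_0[OF lin] using n\<phi> norm_eq_zero by metis
  have "surj \<phi>" using lin i\<phi> linear_injective_imp_surjective by blast
  with i\<phi> have b\<phi>: "bij \<phi>" by (simp add: bij_def)
  have li: "linear (inv \<phi>)" using lin b\<phi> by (rule linear_inv_of_bij)
  have ii: "\<phi> (inv \<phi> x) = x" "inv \<phi> (\<phi> x) = x" for x
    using b\<phi> by (simp_all add: bij_is_surj surj_f_inv_f bij_is_inj)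
  have ni: "norm (inv \<phi> x) = norm x" for x using n\<phi>[of "inv \<phi> x"] by (simp add: ii)
  have pe: "\<phi> e = e" by (simp add: \<phi>_def e)
  \<comment> \<open>Kaplansky's trick: undoing right multiplication by \<open>e\<close> in the first
    argument makes the left unit two-sided. The norm stays multiplicative because
    \<open>\<phi>\<close> is an isometry.\<close>
  define star (infixl "\<star>" 70) where "star x y = m (inv \<phi> x) y" for x y
  have ms: "m x y = \<phi> x \<star> y" for x y by (simp add: star_def ii)
  interpret unital_composition star e
  proof
    show "bilinear star"
      unfolding bilinear_def
      by (auto intro!: linearI simp: star_def linear_add[OF li] linear_scale[OF li]
        bilinear_ladd[OF bm] bilinear_radd[OF bm] bilinear_lmul[OF bm] bilinear_rmul[OF bm])
    show "x \<star> e = x" for x by (simp add: star_def ii flip: \<phi>_def)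
    have "inv \<phi> e = e" using ii(2)[of e] pe by simp
    then show "e \<star> x = x" for x by (simp add: star_def e)
  qed (simp add: star_def nm ni)
  have isom: "\<phi> x \<bullet> \<phi> y = x \<bullet> y" for x y
    using n\<phi>[of "x + y"] n\<phi>[of x] n\<phi>[of y] dot_norm[of "\<phi> x" "\<phi> y"] dot_norm[of x y]
    by (simp add: linear_add[OF lin])
  \<comment> \<open>With \<open>p = m x x\<close> the hypothesis reads \<open>\<phi> (\<phi> p
    \<star> p) \<star> p = \<phi> p \<star> (\<phi> p \<star> p)\<close>. Left alternativity exposes
    a right factor \<open>p\<close> on both sides, which cancels unless it is 0.\<close>
  have sq: "\<phi> (\<phi> (\<phi> x \<star> x) \<star> (\<phi> x \<star> x)) = \<phi> (\<phi> x \<star> x) \<star> \<phi> (\<phi> x \<star> x)" for x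
  proof (cases "\<phi> x \<star> x = 0")
    case True
    then show ?thesis by (simp add: star_simps linear_0[OF lin])
  next
    case False
    define p where "p = \<phi> x \<star> x"
    have "\<phi> (\<phi> p \<star> p) \<star> p = \<phi> p \<star> (\<phi> p \<star> p)"
      using assoc[of x] by (simp add: associator_def ms p_def)
    also have "\<dots> = (\<phi> p \<star> \<phi> p) \<star> p" by (rule left_alternative)
    finally show ?thesis using False star_right_cancel unfolding p_def by blast
  qed
  have inv: "\<phi> (\<phi> x) = x" for x
    using involution_of_square_identity[OF lin i\<phi> pe sq] .
  have frame: "quaternion_frame star e u v"
    if "u \<bullet> u = 1" "v \<bullet> v = 1" "u \<bullet> e = 0" "v \<bullet> e = 0" "u \<bullet> v = 0" for u v
    using that by unfold_locales auto
  obtain u0 where u0: "u0 \<bullet> u0 = 1" "u0 \<bullet> e = 0"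
    using ex_unit_orthogonal[of "{e}"] by auto
  have "card {e, u0} < DIM(real^4)" by (simp add: card_insert_if)
  then obtain v0 where "v0 \<bullet> v0 = 1" "\<And>s. s \<in> {e, u0} \<Longrightarrow> v0 \<bullet> s = 0"
    using ex_unit_orthogonal[of "{e, u0}"] by blast
  then have v0: "v0 \<bullet> v0 = 1" "v0 \<bullet> e = 0" "u0 \<bullet> v0 = 0"
    by (simp_all add: inner_commute)
  interpret f0: quaternion_frame star e u0 v0 by (rule frame) (use u0 v0 in auto)
  consider (pos) "\<And>x. x \<bullet> e = 0 \<Longrightarrow> \<phi> x = x" | (neg) "\<And>x. x \<bullet> e = 0 \<Longrightarrow> \<phi> x = - x"
    | (mixed) x y where "x \<bullet> e = 0" "\<phi> x \<noteq> x" "y \<bullet> e = 0" "\<phi> y \<noteq> - y"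
    by blast
  then show ?thesis
  proof cases
    case pos
    have "\<phi> (f0.comb q) = f0.comb q" for q
      by (simp add: f0.comb_def linear_add[OF lin] linear_scale[OF lin] pe pos f0.frame_inner)
    then have "alg_isomorphic m H_mult"
      by (intro alg_isomorphicI[OF f0.linear_comb f0.inj_comb])
        (simp add: ms H_mult_def f0.comb_qmult)
    then show ?thesis by simp
  next
    case neg
    have "\<phi> (f0.comb q) = f0.comb (qconj q)" for q
      by (simp add: f0.comb_def qconj_def linear_add[OF lin] linear_scale[OF lin] pe neg f0.frame_inner)
    then have "alg_isomorphic m starH_mult"
      by (intro alg_isomorphicI[OF f0.linear_comb f0.inj_comb])
        (simp add: ms starH_mult_def f0.comb_qmult)
    then show ?thesis by simp
  next
    case mixed
    have normalize: "\<exists>u. u \<bullet> u = 1 \<and> u \<bullet> e = 0 \<and> \<phi> u = c *\<^sub>R u"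
      if "z \<noteq> 0" "z \<bullet> e = 0" "\<phi> z = c *\<^sub>R z" for z c
      using that by (intro exI[of _ "inverse (norm z) *\<^sub>R z"])
        (simp add: linear_scale[OF lin] dot_square_norm power2_eq_square)
    have \<phi>e: "\<phi> x \<bullet> e = x \<bullet> e" for x using isom[of x e] by (simp add: pe)
    \<comment> \<open>As \<open>\<phi>\<close> is an involution, \<open>x - \<phi> x\<close> and
      \<open>y + \<phi> y\<close> are eigenvectors for -1 and 1; the case assumptions say that they
      are nonzero.\<close>
    obtain u where u: "u \<bullet> u = 1" "u \<bullet> e = 0" "\<phi> u = - u"
      using normalize[of "x - \<phi> x" "-1"] mixed
      by (auto simp: linear_diff[OF lin] inv inner_diff_left \<phi>e)
    obtain v where v: "v \<bullet> v = 1" "v \<bullet> e = 0" "\<phi> v = v"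
      using normalize[of "y + \<phi> y" 1] mixed
      by (auto simp: linear_add[OF lin] inv inner_add_left \<phi>e add.commute add_eq_0_iff)
    have uv: "u \<bullet> v = 0" using isom[of u v] u v by simp
    interpret f: quaternion_frame star e u v by (rule frame) (use u v uv in auto)
    have "surj f.comb" using f.linear_comb f.inj_comb linear_injective_imp_surjective by blast
    then obtain q where q: "\<phi> f.w = f.comb q" by (metis surjD)
    \<comment> \<open>The isometry \<open>\<phi>\<close> sends \<open>e\<close>, \<open>u\<close>,
      \<open>v\<close> to themselves up to sign, so it sends \<open>f.w\<close> to a unit vector
      orthogonal to all three.\<close>
    have "\<phi> f.w \<bullet> e = 0" "\<phi> f.w \<bullet> u = 0" "\<phi> f.w \<bullet> v = 0" "\<phi> f.w \<bullet> \<phi> f.w = 1"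
      using isom[of f.w e] isom[of f.w u] isom[of f.w v] isom[of f.w f.w] pe u v
      by (simp_all add: f.frame_inner)
    then have "q $ 1 = 0" "q $ 2 = 0" "q $ 3 = 0" "q $ 4 * q $ 4 = 1"
      by (simp_all add: q f.comb_def inner_add_left inner_add_right f.frame_inner)
    then have "\<phi> f.w = f.w \<or> \<phi> f.w = - f.w"
      using square_eq_1_iff[of "q $ 4"] by (auto simp: q f.comb_def)
    \<comment> \<open>The vector \<open>u + v\<close> has square \<open>- 2 *\<^sub>R f.w\<close>
      under \<open>m\<close>. If \<open>\<phi>\<close> negated \<open>f.w\<close>, the identity
      \<open>sq\<close> would then equate \<open>4 *\<^sub>R e\<close> with its negative.\<close>
    moreover have "\<phi> f.w \<noteq> - f.w"
    proof
      assume w: "\<phi> f.w = - f.w"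
      have "\<phi> (u + v) \<star> (u + v) = - 2 *\<^sub>R f.w"
        by (simp add: linear_add[OF lin] u v star_simps f.table scaleR_2)
      with sq[of "u + v"]
      have "\<phi> (\<phi> (- 2 *\<^sub>R f.w) \<star> (- 2 *\<^sub>R f.w)) = \<phi> (- 2 *\<^sub>R f.w) \<star> \<phi> (- 2 *\<^sub>R f.w)"
        by (simp only:)
      then have "4 *\<^sub>R e = - 4 *\<^sub>R e"
        by (simp add: w linear_scale[OF lin] linear_neg[OF lin] pe star_simps f.table)
      then have "8 *\<^sub>R e = 0" by (simp add: eq_neg_iff_add_eq_0 flip: scaleR_add_left)
      then show False using inner_unit by simp
    qed
    ultimately have w: "\<phi> f.w = f.w" by blast
    \<comment> \<open>The vector is the quaternion product \<open>-i q\<close>, so the left unit i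
      of the model goes to \<open>e\<close>. In frame coordinates \<open>\<phi>\<close> is
      \<open>q \<mapsto> i (qconj q) (-i)\<close>; hence both sides of the homomorphism law are
      \<open>f.comb\<close> of \<open>-i (qconj x) i y\<close>.\<close>
    define k where "k q = f.comb (vector [q$2, - q$1, q$4, - q$3])" for q :: "real^4"
    have lk: "linear k"
      by (rule linearI) (simp_all add: k_def f.comb_def algebra_simps)
    have ik: "inj k"
      unfolding linear_injective_0[OF lk]
    proof (intro allI impI)
      fix q :: "real^4" assume "k q = 0"
      then have "(vector [q$2, - q$1, q$4, - q$3] :: real^4) = 0"
        using f.inner_comb by (metis inner_eq_zero_iff k_def)
      then show "q = 0" by (simp add: vec_eq_iff forall_4)
    qed
    have "k (starHi1_mult x y) = m (k x) (k y)" for x y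
      by (simp add: ms k_def f.comb_def linear_add[OF lin] linear_diff[OF lin] linear_scale[OF lin] pe u v w
          star_simps f.table starHi1_mult_def qmult_def qconj_def qi_def algebra_simps)
    then have "alg_isomorphic m starHi1_mult" by (rule alg_isomorphicI[OF lk ik])
    then show ?thesis by simp
  qed
qed

section \<open>Degrees of the three algebras\<close>

lemma gen_subalg_least:
  assumes "subspace S" "x \<in> S" "\<And>a b. a \<in> S \<Longrightarrow> b \<in> S \<Longrightarrow> m a b \<in> S"
  shows "gen_subalg m x \<subseteq> S"
  using assms by (auto simp: gen_subalg_def)

lemma gen_subalg_self: "x \<in> gen_subalg m x"
  and gen_subalg_mult: "a \<in> gen_subalg m x \<Longrightarrow> b \<in> gen_subalg m x \<Longrightarrow> m a b \<in> gen_subalg m x"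
  and subspace_gen_subalg: "subspace (gen_subalg m x)"
  unfolding gen_subalg_def by (blast, blast) (auto intro: subspace_Inter)

lemma alg_degree_eqI:
  assumes "\<And>x. dim (gen_subalg m x) \<le> n" "n \<le> dim (gen_subalg m y)"
  shows "alg_degree m = n"
  unfolding alg_degree_def
  by (rule Least_equality) (use assms order_trans in blast)+

definition q1 :: "real^4" where "q1 = vector [1, 0, 0, 0]"

lemmas quat_simps = vec_eq_iff forall_4 qmult_def qconj_def qi_def q1_def H_mult_def starH_mult_def
  starHi1_mult_def

lemma span_q1:
  "z \<in> span {q1, x} \<longleftrightarrow> (\<exists>a b. z = a *\<^sub>R q1 + b *\<^sub>R x)"
  by (auto simp: span_insert span_singleton algebra_simps)

text \<open>Every quaternion satisfies \<open>x^2 = 2 Re(x) x - |x|^2\<close> and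
  \<open>qconj x = 2 Re(x) - x\<close>, so the span of 1 and \<open>x\<close> is closed under both
  products.\<close>

lemma dim_gen_subalg_le_2:
  "dim (gen_subalg H_mult x) \<le> 2" "dim (gen_subalg starH_mult x) \<le> 2"
proof -
  let ?S = "span {q1, x}"
  have d: "dim ?S \<le> 2"
    using dim_le_card'[of "{q1, x}"] by (simp add: card_insert_if split: if_splits)
  have conj: "qconj a \<in> ?S" if a: "a \<in> ?S" for a
  proof -
    obtain s t where "a = s *\<^sub>R q1 + t *\<^sub>R x" using a span_q1 by blast
    then have "qconj a = (s + 2 * t * x$1) *\<^sub>R q1 + (- t) *\<^sub>R x"
      by (simp add: quat_simps algebra_simps)
    then show ?thesis using span_q1 by blast
  qed
  have mult: "qmult a b \<in> ?S" if ab: "a \<in> ?S" "b \<in> ?S" for a b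
  proof -
    obtain s t where a: "a = s *\<^sub>R q1 + t *\<^sub>R x" using ab span_q1 by blast
    obtain s' t' where b: "b = s' *\<^sub>R q1 + t' *\<^sub>R x" using ab span_q1 by blast
    have "qmult a b = (s * s' - t * t' * (x \<bullet> x)) *\<^sub>R q1 + (s * t' + t * s' + 2 * t * t' * x$1) *\<^sub>R x"
      by (simp add: a b quat_simps inner_vec_def sum_4 algebra_simps)
    then show ?thesis using span_q1 by blast
  qed
  have "gen_subalg H_mult x \<subseteq> ?S" "gen_subalg starH_mult x \<subseteq> ?S"
    by (rule gen_subalg_least; simp add: H_mult_def starH_mult_def mult conj span_base)+
  then show "dim (gen_subalg H_mult x) \<le> 2" "dim (gen_subalg starH_mult x) \<le> 2"
    using d dim_subset order_trans by blast+
qed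

lemma dim_ge_2I:
  assumes "qi \<in> S" "q1 \<in> S"
  shows "2 \<le> dim (S :: (real^4) set)"
proof -
  have "independent {q1, qi}"
    by (rule pairwise_orthogonal_independent)
      (auto simp: pairwise_insert orthogonal_def inner_vec_def sum_4 quat_simps)
  moreover have "card {q1, qi} = 2" by (simp add: quat_simps card_insert_if)
  ultimately show ?thesis using assms independent_card_le_dim[of "{q1, qi}" S] by simp
qed

lemma alg_degree_H: "alg_degree H_mult = 2"
proof (rule alg_degree_eqI[where y = qi])
  let ?G = "gen_subalg H_mult qi"
  have "- H_mult qi qi \<in> ?G"
    by (intro subspace_neg subspace_gen_subalg gen_subalg_mult gen_subalg_self)
  moreover have "- H_mult qi qi = q1" by (simp add: quat_simps)
  ultimately show "2 \<le> dim ?G"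
    using gen_subalg_self by (intro dim_ge_2I) auto
qed (rule dim_gen_subalg_le_2)

lemma alg_degree_starH: "alg_degree starH_mult = 2"
proof (rule alg_degree_eqI[where y = qi])
  let ?G = "gen_subalg starH_mult qi"
  have "starH_mult qi qi \<in> ?G"
    by (intro gen_subalg_mult gen_subalg_self)
  moreover have "starH_mult qi qi = q1" by (simp add: quat_simps)
  ultimately show "2 \<le> dim ?G"
    using gen_subalg_self by (intro dim_ge_2I) auto
qed (rule dim_gen_subalg_le_2)

text \<open>In \<open>\<^sup>*\<H>(i,1)\<close> the element \<open>x = 1 + j\<close> satisfies \<open>x \<odot> x = 2 k\<close>, \<open>k \<odot> k = - i\<close> and
  \<open>x \<odot> i = - 1 + j\<close>, so it generates the whole algebra.\<close>

lemma alg_degree_starHi1: "alg_degree starHi1_mult = 4"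
proof (rule alg_degree_eqI)
  show "dim (gen_subalg starHi1_mult x) \<le> 4" for x
    using dim_subset_UNIV[of "gen_subalg starHi1_mult x"] by simp
  define x :: "real^4" where "x = vector [1, 0, 1, 0]"
  let ?m = starHi1_mult
  let ?G = "gen_subalg ?m x"
  define y z where "y = ?m x x" and "z = ?m y y"
  have G: "x \<in> ?G" "y \<in> ?G" "z \<in> ?G" "?m x z \<in> ?G"
    unfolding y_def z_def by (intro gen_subalg_self gen_subalg_mult)+
  \<comment> \<open>Here \<open>y = 2k\<close>, \<open>z = -4i\<close> and
    \<open>?m x z = 4 - 4j\<close>, from which the coefficients are read off.\<close>
  have "q = ((q$1 + q$3) / 2) *\<^sub>R x + (q$4 / 2) *\<^sub>R y + (- q$2 / 4) *\<^sub>R z + ((q$1 - q$3) / 8) *\<^sub>R ?m x z" for q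
    by (simp add: y_def z_def x_def quat_simps field_simps)
  moreover have "a *\<^sub>R x + b *\<^sub>R y + c *\<^sub>R z + d *\<^sub>R ?m x z \<in> ?G" for a b c d
    using subspace_gen_subalg[of ?m x] by (intro subspace_add subspace_scale G)
  ultimately have "?G = UNIV" by (metis UNIV_eq_I)
  then show "4 \<le> dim ?G" by simp
qed

theorem theorem4:
  fixes m :: "'a::real_normed_vector \<Rightarrow> 'a \<Rightarrow> 'a"
  assumes "absolute_valued m"
    and "dim (UNIV :: 'a set) = 4"
    and "has_left_unit m"
    and "\<forall>x. associator m (m x x) (m x x) (m x x) = 0"
  shows "(alg_isomorphic m H_mult \<or> alg_isomorphic m starH_mult \<or> alg_isomorphic m starHi1_mult)
    \<and> alg_degree starHi1_mult = 4 \<and> alg_degree H_mult = 2 \<and> alg_degree starH_mult = 2"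
proof -
  obtain m' :: "real^4 \<Rightarrow> real^4 \<Rightarrow> real^4" and T where m': "absolute_valued m'" and T: "alg_iso m' m T"
    using absolute_valued_euclidean_model[OF assms(1,2)] .
  have S: "alg_iso m m' (inv T)" using T by (rule alg_iso_inv)
  have lT: "linear T" and injT: "inj T" and surjT: "surj T" and Tm: "T (m' x y) = m (T x) (T y)" for x y
    using T by (auto simp: alg_iso_def bij_def)
  from assms(3) obtain e where e: "\<And>x. m e x = x" by (auto simp: has_left_unit_def)
  have "m' (inv T e) x = x" for x
    by (rule injD[OF injT]) (simp add: Tm surj_f_inv_f[OF surjT] e)
  moreover have "associator m' (m' x x) (m' x x) (m' x x) = 0" for x
    by (rule injD[OF injT])
      (use assms(4) in \<open>simp add: associator_def linear_diff[OF lT] linear_0[OF lT] Tm\<close>)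
  ultimately have "alg_isomorphic m' H_mult \<or> alg_isomorphic m' starH_mult \<or> alg_isomorphic m' starHi1_mult"
    by (rule real4_classification[OF m'])
  then have "alg_isomorphic m H_mult \<or> alg_isomorphic m starH_mult \<or> alg_isomorphic m starHi1_mult"
    using alg_iso_comp[OF S] unfolding alg_isomorphic_def by blast
  then show ?thesis using alg_degree_starHi1 alg_degree_H alg_degree_starH by blast
qed

end
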